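(* For every integer $m\ge3$ there is a polynomial $E(w)\in\mathbb Q[w]$ such that $$D(w)=\begin{cases}E(w)^3, & 3\nmid m,\\ \big(w^2-\tfrac{27}{4}\big)E(w)^3, & 3\mid m.\end{cases}$$ As such, $\deg E=(m-1)(m-2)/3$ if $3\nmid m$ and $\deg E=((m-1)(m-2)-2)/3$ if $3\mid m$.
   Context: For an integer $m\ge3$, set $Q(u):=u^m-i^m$ and $W(u,v,w):=iu^2v^2+u^2v+uv^2-2wuv+u+v-i$ with $i=\sqrt{-1}$, and $$D(w)=\frac{1}{2^{m^2}w^{3m-2}}\operatorname{Res}_u\Big(Q(u),\ \operatorname{Res}_v\big(Q(v),\,W(u,v,w)\big)\Big),$$ where $\operatorname{Res}_x$ is the resultant (Sylvester determinant) with respect to $x$. Equivalently, $D$ is the spectral determinant polynomial $$D(w)=\prod_{(a,b)}(w-r_{a,b}),\qquad r_{a,b}=-\sin\tfrac{2\pi a}{m}-\sin\tfrac{2\pi b}{m}+\sin\tfrac{2\pi(a+b)}{m},$$ the product running over all $(a,b)\in(\mathbb Z/m\mathbb Z)^2$ with $a\ne0$, $b\neq0$ and $a+b\not\equiv0\bmod m$; it is monic of degree $(m-1)(m-2)$. *)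

theory Defs
  imports
    Complex_Main
    "HOL-Computational_Algebra.Fraction_Field"
    "HOL-Computational_Algebra.Polynomial_Factorial"
    "Subresultants.Resultant_Prelim"
begin

text \<open>
  \<open>Q\<close> and \<open>W\<close> are written over an arbitrary commutative ring, with the image \<open>\<iota>\<close> of
  the imaginary unit as a parameter, so that the same formulas can be read in each of the
  polynomial rings below.
\<close>

definition Q_form :: "'a::comm_ring_1 \<Rightarrow> nat \<Rightarrow> 'a \<Rightarrow> 'a" where
  "Q_form \<iota> m u = u ^ m - \<iota> ^ m"

definition W_form :: "'a::comm_ring_1 \<Rightarrow> 'a \<Rightarrow> 'a \<Rightarrow> 'a \<Rightarrow> 'a" where
  "W_form \<iota> u v w =
     \<iota> * u^2 * v^2 + u^2 * v + u * v^2 - 2 * w * u * v + u + v - \<iota>"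

text \<open>
  The nested type \<open>complex poly poly poly\<close> is read as the ring of polynomials in \<open>v\<close>
  over polynomials in \<open>u\<close> over polynomials in \<open>w\<close>: the outermost variable is \<open>v\<close>, the
  innermost one \<open>w\<close>.
\<close>

definition Q_v :: "nat \<Rightarrow> complex poly poly poly" where
  "Q_v m = Q_form [:[:[:\<i>:]:]:] m [:0, 1:]"

definition Q_u :: "nat \<Rightarrow> complex poly poly" where
  "Q_u m = Q_form [:[:\<i>:]:] m [:0, 1:]"

definition W_poly :: "complex poly poly poly" where
  "W_poly = W_form [:[:[:\<i>:]:]:] [:[:0, 1:]:] [:0, 1:] [:[:[:0, 1:]:]:]"

definition iterated_resultant :: "nat \<Rightarrow> complex poly" where
  "iterated_resultant m = resultant (Q_u m) (resultant (Q_v m) W_poly)"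

text \<open>
  The quotient is taken in the field of rational functions in \<open>w\<close>, because \<open>div\<close> on
  polynomials would silently discard a remainder.
\<close>

definition D :: "nat \<Rightarrow> complex poly fract" where
  "D m = Fract (iterated_resultant m) (2 ^ (m ^ 2) * [:0, 1:] ^ (3 * m - 2))"

end

theory Submission
  imports Defs "HOL-Computational_Algebra.Fundamental_Theorem_Algebra"
begin

text \<open>
  At the roots \<open>u = \<i> x\<close> and \<open>v = \<i> y\<close> of \<open>Q\<close>, with \<open>x\<close> and \<open>y\<close> running over the \<open>m\<close>-th
  roots of unity, \<open>W\<close> equals \<open>2 x y (w - r)\<close> for a spectral root \<open>r\<close>. The product formula for
  resultants therefore identifies \<open>D\<close> with the product of the factors \<open>w - r\<close> over the pairs
  \<open>(a, b)\<close> with \<open>a\<close>, \<open>b\<close>, \<open>a + b\<close> nonzero modulo \<open>m\<close>; the other \<open>3 m - 2\<close> pairs have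
  \<open>r = 0\<close>. With \<open>c \<equiv> - a - b\<close> the root is minus the sum of the sines of the angles of
  \<open>a\<close>, \<open>b\<close>, \<open>c\<close>, so it is invariant under cyclic shifts of \<open>(a, b, c)\<close>. Orbits of length
  three contribute cubes; the fixed points \<open>a = b = c\<close> exist only for \<open>3 dvd m\<close> and have
  the roots \<open>\<plusminus> 3 \<surd>3 / 2\<close>, whence \<open>w\<^sup>2 - 27/4\<close>. Finally \<open>D\<close> has coefficients in \<open>\<rat>(\<i>)\<close> and
  real roots, hence rational coefficients, and these determine the coefficients of the monic
  \<open>E\<close> recursively from the top.
\<close>

section \<open>The product formula for resultants\<close>

text \<open>As a left factor it adds \<open>\<gamma> i\<close> times row \<open>i + 1\<close> to row
  \<open>i\<close>; as a right factor it adds \<open>\<gamma> (j - 1)\<close> times column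
  \<open>j - 1\<close> to column \<open>j\<close>. Both operations preserve determinants.\<close>

definition bidiagonal_mat :: "nat \<Rightarrow> (nat \<Rightarrow> 'a) \<Rightarrow> 'a::comm_ring_1 mat" where
  "bidiagonal_mat N \<gamma> = mat N N (\<lambda>(i, j). if i = j then 1 else if j = Suc i then \<gamma> i else 0)"

lemma bidiagonal_mat_carrier [simp]: "bidiagonal_mat N \<gamma> \<in> carrier_mat N N"
  by (simp add: bidiagonal_mat_def)

lemma det_bidiagonal_mat [simp]: "det (bidiagonal_mat N \<gamma>) = 1"
proof -
  have "upper_triangular (bidiagonal_mat N \<gamma>)"
    by (rule upper_triangularI) (simp add: bidiagonal_mat_def)
  from det_upper_triangular[OF this bidiagonal_mat_carrier] show ?thesis
    by (simp add: prod_list_diag_prod) (simp add: bidiagonal_mat_def)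
qed

lemma bidiagonal_mat_mult_index:
  assumes "M \<in> carrier_mat N N" "i < N" "j < N"
  shows "(bidiagonal_mat N \<gamma> * M) $$ (i, j) =
    M $$ (i, j) + (if Suc i < N then \<gamma> i * M $$ (Suc i, j) else 0)"
proof -
  have "(bidiagonal_mat N \<gamma> * M) $$ (i, j) =
      (\<Sum>k\<in>{0..<N}. bidiagonal_mat N \<gamma> $$ (i, k) * M $$ (k, j))"
    using assms by (simp add: scalar_prod_def bidiagonal_mat_def)
  also have "\<dots> = (\<Sum>k\<in>{0..<N}. (if k = i then M $$ (k, j) else 0) +
      (if k = Suc i then \<gamma> i * M $$ (k, j) else 0))"
    using assms by (intro sum.cong) (auto simp: bidiagonal_mat_def)
  finally show ?thesis
    using assms by (simp add: sum.distrib)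
qed

lemma mult_bidiagonal_mat_index:
  assumes "M \<in> carrier_mat N N" "i < N" "j < N"
  shows "(M * bidiagonal_mat N \<gamma>) $$ (i, j) =
    M $$ (i, j) + (if 0 < j then M $$ (i, j - 1) * \<gamma> (j - 1) else 0)"
proof -
  have "(M * bidiagonal_mat N \<gamma>) $$ (i, j) =
      (\<Sum>k\<in>{0..<N}. M $$ (i, k) * bidiagonal_mat N \<gamma> $$ (k, j))"
    using assms by (simp add: scalar_prod_def bidiagonal_mat_def)
  also have "\<dots> = (\<Sum>k\<in>{0..<N}. (if k = j then M $$ (i, k) else 0) +
      (if k = j - 1 then (if 0 < j then M $$ (i, k) * \<gamma> k else 0) else 0))"
    using assms by (intro sum.cong) (auto simp: bidiagonal_mat_def)
  finally show ?thesis
    using assms by (simp add: sum.distrib)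
qed

text \<open>Each row is the coefficient vector, in descending degree, of a monomial multiple of
  \<open>p\<close> or \<open>q\<close>, so row operations become polynomial identities. The degree
  bounds account for the zeros off the band.\<close>

lemma sylvester_mat_sub_index_monom:
  fixes p q :: "'a::comm_ring_1 poly"
  assumes "degree p \<le> m" "degree q \<le> n" "i < m + n" "j < m + n"
  shows "sylvester_mat_sub m n p q $$ (i, j) =
    coeff (if i < n then monom 1 (n - 1 - i) * p else monom 1 (m + n - 1 - i) * q) (m + n - 1 - j)"
proof -
  consider "i < n" "i \<le> j" "j - i \<le> m" | "i < n" "j < i" | "i < n" "i \<le> j" "j - i > m"
    | "i \<ge> n" "i - n \<le> j" "j \<le> i" | "i \<ge> n" "j > i" | "i \<ge> n" "i - n > j"
    by linarith
  then show ?thesis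
  proof cases
    case 2
    then have "coeff p (m + n - 1 - j - (n - 1 - i)) = 0" using assms by (intro coeff_eq_0) auto
    then show ?thesis using assms 2 by (auto simp: sylvester_mat_sub_index coeff_monom_mult)
  next
    case 6
    then have "coeff q (m + n - 1 - j - (m + n - 1 - i)) = 0" using assms by (intro coeff_eq_0) auto
    then show ?thesis using assms 6 by (auto simp: sylvester_mat_sub_index coeff_monom_mult)
  qed (use assms in \<open>auto simp: sylvester_mat_sub_index coeff_monom_mult intro!: arg_cong[of _ _ "coeff _"]\<close>)
qed

text \<open>
  Dividing a row polynomial by \<open>X - c\<close> and recording quotient and remainder is a unitriangular
  change of basis. After replacing each row \<open>X\<^sup>k g\<close> with \<open>k > 0\<close> by \<open>(X - c) X\<^bsup>k-1\<^esup> g\<close>, it turns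
  the Sylvester matrix of \<open>(X - c) f\<close> and \<open>g\<close> into that of \<open>f\<close> and \<open>g\<close>, bordered by a
  column whose only nonzero entry is the corner \<open>g(c)\<close>.
\<close>
lemma resultant_sub_linear_mult:
  fixes f g :: "'a::comm_ring_1 poly"
  assumes f: "degree f \<le> m" and g: "degree g \<le> n"
  shows "resultant_sub (Suc m) n ([:-c, 1:] * f) g = poly g c * resultant_sub m n f g"
proof -
  define N where "N = Suc (m + n)"
  define F where "F = [:-c, 1:] * f"
  define S where "S = sylvester_mat_sub (Suc m) n F g"
  define L where "L = bidiagonal_mat N (\<lambda>i. if i < n then 0 else -c)"
  define R where "R = bidiagonal_mat N (\<lambda>_. -c)"
  \<comment> \<open>\<open>Q i\<close> and \<open>r i\<close> are quotient and remainder modulo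
    \<open>X - c\<close> of row \<open>i\<close> after the row operation \<open>L\<close>. Only the
    last row, \<open>g\<close> itself, leaves a remainder.\<close>
  define Q where "Q i = (if i < n then monom 1 (n - 1 - i) * f
      else if i < N - 1 then monom 1 (N - 2 - i) * g else synthetic_div g c)" for i
  define r where "r i = (if i = N - 1 then poly g c else 0)" for i
  define B where "B = mat N N (\<lambda>(i, j). if j = N - 1 then r i else coeff (Q i) (N - 2 - j))"
  have F: "degree F \<le> Suc m"
    using degree_mult_le[of "[:-c, 1:]" f] f by (simp add: F_def)
  have S: "S \<in> carrier_mat N N" and B: "B \<in> carrier_mat N N"
    by (auto simp: S_def B_def N_def)
  define P where "P i = (if i < n then monom 1 (n - 1 - i) * F else monom 1 (N - 1 - i) * g)" for i
  have S_index: "S $$ (i, j) = coeff (P i) (N - 1 - j)" if "i < N" "j < N" for i j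
    using sylvester_mat_sub_index_monom[OF F g, of i j] that by (simp add: S_def P_def N_def)
  have P_eq: "P i + (if Suc i < N then smult (if i < n then 0 else -c) (P (Suc i)) else 0)
      = [:-c, 1:] * Q i + [:r i:]" if iN: "i < N" for i
  proof -
    consider "i < n" | "i \<ge> n" "Suc i < N" | "i \<ge> n" "Suc i = N"
      using iN by (meson Suc_lessI linorder_not_less)
    then show ?thesis
    proof cases
      case 1
      then show ?thesis by (simp add: P_def Q_def r_def F_def N_def algebra_simps)
    next
      case 2
      define k where "k = N - 2 - i"
      have "i < N - 1" "i \<noteq> N - 1" "N - 1 - i = Suc k" "N - 1 - Suc i = k"
        using 2 by (auto simp: k_def)
      then have "P i = pCons 0 (monom 1 k * g)" "P (Suc i) = monom 1 k * g"
        "Q i = monom 1 k * g" "r i = 0"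
        using 2 by (simp_all add: P_def Q_def r_def k_def monom_Suc)
      then show ?thesis
        using 2 by simp
    next
      case 3
      have "\<not> i < N - 1" "i = N - 1" "\<not> i < n" "N - 1 - i = 0" "\<not> Suc i < N" using 3 by auto
      then show ?thesis
        using synthetic_div_correct'[of c g] by (simp add: P_def Q_def r_def)
    qed
  qed
  \<comment> \<open>The quotients fit into the first \<open>N - 1\<close> columns of
    \<open>B\<close>; this settles column 0, which has no left neighbour.\<close>
  have Q0: "coeff (Q i) (N - 1) = 0" if iN: "i < N" for i
  proof -
    consider "i < n" | "i \<ge> n" "Suc i < N" | "i \<ge> n" "Suc i = N"
      using iN by (meson Suc_lessI linorder_not_less)
    then show ?thesis
    proof cases
      case 1
      then have "coeff f (N - 1 - (n - 1 - i)) = 0" using f by (intro coeff_eq_0) (simp add: N_def)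
      then show ?thesis using 1 by (simp add: Q_def coeff_monom_mult)
    next
      case 2
      then have "coeff g (N - 1 - (N - 2 - i)) = 0" using g by (intro coeff_eq_0) auto
      moreover have "i < N - 1" "N - 2 - i \<le> N - 1" using 2 by linarith+
      ultimately show ?thesis using 2 by (simp add: Q_def coeff_monom_mult)
    next
      case 3
      show ?thesis
      \<comment> \<open>A constant \<open>g\<close> is treated apart: degree 0 is not below
        \<open>N - 1\<close> when \<open>N = 1\<close>.\<close>
      proof (cases "degree g = 0")
        case True
        then have "synthetic_div g c = 0" by (simp add: synthetic_div_eq_0_iff)
        then show ?thesis using 3 by (simp add: Q_def)
      next
        case False
        then have "coeff (synthetic_div g c) (N - 1) = 0"
          using g by (intro coeff_eq_0) (simp add: degree_synthetic_div N_def)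
        then show ?thesis using 3 by (simp add: Q_def)
      qed
    qed
  qed
  have "L * S = B * R"
  proof (rule eq_matI)
    fix i j assume "i < dim_row (B * R)" "j < dim_col (B * R)"
    then have ij: "i < N" "j < N" using B by (auto simp: R_def bidiagonal_mat_def)
    have "(L * S) $$ (i, j) =
        coeff (P i + (if Suc i < N then smult (if i < n then 0 else -c) (P (Suc i)) else 0)) (N - 1 - j)"
      using ij by (simp add: L_def bidiagonal_mat_mult_index[OF S] S_index)
    also have "\<dots> = coeff ([:-c, 1:] * Q i + [:r i:]) (N - 1 - j)"
      using P_eq ij by simp
    also have "\<dots> = B $$ (i, j) + (if 0 < j then B $$ (i, j - 1) * (-c) else 0)"
    proof (cases "j = N - 1")
      case True
      then show ?thesis
        using ij Q0[of i] by (cases "j = 0") (auto simp: B_def)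
    next
      case False
      then have k: "N - 1 - j = Suc (N - 2 - j)"
        using ij by linarith
      have "coeff (Q i) (Suc (N - 2 - j)) = coeff (Q i) (N - 2 - (j - 1))" if "0 < j"
        using k that by (intro arg_cong[of _ _ "coeff _"]) linarith
      moreover have "coeff (Q i) (Suc (N - 2 - j)) = 0" if "j = 0"
        using Q0[of i] k ij that by simp
      moreover have "B $$ (i, j) = coeff (Q i) (N - 2 - j)"
        using ij False by (simp add: B_def)
      moreover have "B $$ (i, j - 1) = coeff (Q i) (N - 2 - (j - 1))" if "0 < j"
      proof -
        have "j - 1 \<noteq> N - 1" using ij that by linarith
        then show ?thesis using ij by (simp add: B_def)
      qed
      ultimately show ?thesis
        unfolding k by (cases "j = 0") simp_all
    qed
    also have "\<dots> = (B * R) $$ (i, j)"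
      using ij by (simp add: R_def mult_bidiagonal_mat_index[OF B])
    finally show "(L * S) $$ (i, j) = (B * R) $$ (i, j)" .
  qed (use S B in \<open>auto simp: L_def R_def bidiagonal_mat_def\<close>)
  then have "det S = det B"
    using det_mult[of L N S] det_mult[of B N R] S B by (simp add: L_def R_def)
  also have "det B = (\<Sum>i<N. B $$ (i, N - 1) * cofactor B i (N - 1))"
    using B by (intro laplace_expansion_column) (auto simp: N_def)
  also have "\<dots> = (\<Sum>i<N. if i = N - 1 then poly g c * cofactor B i (N - 1) else 0)"
    by (intro sum.cong) (auto simp: B_def r_def)
  also have "\<dots> = poly g c * det (mat_delete B (N - 1) (N - 1))"
    by (simp add: N_def cofactor_def flip: mult_2)
  also have "mat_delete B (N - 1) (N - 1) = sylvester_mat_sub m n f g"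
    using B
    by (intro eq_matI)
      (auto simp: mat_delete_def B_def sylvester_mat_sub_index_monom[OF f g] Q_def N_def)
  finally show ?thesis
    by (simp add: resultant_sub_def S_def F_def)
qed

lemma degree_prod_linear:
  "degree (\<Prod>i\<in>I. [:- c i, 1:] :: 'a::idom poly) = card I"
  by (subst degree_prod_sum_eq) auto

text \<open>Linear factors are peeled off one at a time while the formal degree \<open>n\<close> of
  \<open>g\<close> stays fixed; with no factor left, the matrix is the identity.\<close>

lemma resultant_sub_prod_linear:
  fixes c :: "'b \<Rightarrow> 'a::idom"
  assumes "finite I" "degree g \<le> n"
  shows "resultant_sub (card I) n (\<Prod>i\<in>I. [:- c i, 1:]) g = (\<Prod>i\<in>I. poly g (c i))"
  using assms(1)
proof (induction I)
  case empty
  have "sylvester_mat_sub 0 n 1 g = 1\<^sub>m n"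
    by (rule eq_matI) (auto simp: sylvester_mat_sub_index)
  then show ?case by (simp add: resultant_sub_def)
next
  case (insert x I)
  then show ?case
    using resultant_sub_linear_mult[of "\<Prod>i\<in>I. [:- c i, 1:]" "card I" g n "c x"] assms(2)
    by (simp add: degree_prod_linear del: mult_pCons_left)
qed

theorem resultant_prod_linear:
  fixes c :: "'b \<Rightarrow> 'a::idom"
  assumes "finite I"
  shows "resultant (\<Prod>i\<in>I. [:- c i, 1:]) g = (\<Prod>i\<in>I. poly g (c i))"
  using resultant_sub_prod_linear[OF assms order_refl] by (simp add: resultant_sub degree_prod_linear)

section \<open>Rationality of coefficients\<close>

text \<open>Stated for sets, so that membership passes through nested polynomial rings by repeated
  use of \<open>unital_subring_poly\<close>.\<close>

locale unital_subring =
  fixes S :: "'a::comm_ring_1 set"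
  assumes one_mem: "1 \<in> S"
    and diff_mem: "x \<in> S \<Longrightarrow> y \<in> S \<Longrightarrow> x - y \<in> S"
    and mult_mem: "x \<in> S \<Longrightarrow> y \<in> S \<Longrightarrow> x * y \<in> S"
begin

lemma zero_mem: "0 \<in> S"
  using diff_mem[OF one_mem one_mem] by simp

lemma uminus_mem: "x \<in> S \<Longrightarrow> - x \<in> S"
  using diff_mem[OF zero_mem, of x] by simp

lemma add_mem: "x \<in> S \<Longrightarrow> y \<in> S \<Longrightarrow> x + y \<in> S"
  using diff_mem[of x "- y"] uminus_mem[of y] by simp

lemma sum_mem: "(\<And>i. i \<in> I \<Longrightarrow> f i \<in> S) \<Longrightarrow> sum f I \<in> S"
  by (induction I rule: infinite_finite_induct) (auto intro: zero_mem add_mem)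

lemma prod_mem: "(\<And>i. i \<in> I \<Longrightarrow> f i \<in> S) \<Longrightarrow> prod f I \<in> S"
  by (induction I rule: infinite_finite_induct) (auto intro: one_mem mult_mem)

lemma power_mem: "x \<in> S \<Longrightarrow> x ^ n \<in> S"
  by (induction n) (auto intro: one_mem mult_mem)

lemma of_nat_mem: "of_nat n \<in> S"
  by (induction n) (auto intro: one_mem zero_mem add_mem)

lemma det_mem:
  assumes "\<And>i j. i < dim_row A \<Longrightarrow> j < dim_col A \<Longrightarrow> A $$ (i, j) \<in> S"
  shows "det A \<in> S"
proof (cases "dim_row A = dim_col A")
  case True
  have "signof p \<in> S" for p
    by (simp add: sign_def one_mem uminus_mem)
  moreover have "A $$ (i, p i) \<in> S" if "p permutes {0..<dim_row A}" "i < dim_row A" for p i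
    using assms[of i "p i"] that True permutes_in_image[OF that(1), of i] by simp
  ultimately show ?thesis
    using True by (auto simp: det_def intro!: sum_mem mult_mem prod_mem)
\<comment> \<open>A non-square matrix has determinant 0 by definition.\<close>
qed (simp add: det_def zero_mem)

lemma resultant_mem:
  assumes "\<And>n. coeff p n \<in> S" "\<And>n. coeff q n \<in> S"
  shows "resultant p q \<in> S"
  unfolding resultant_def
  by (rule det_mem) (auto simp: sylvester_index_mat assms zero_mem)

lemma unital_subring_poly: "unital_subring {p. \<forall>n. coeff p n \<in> S}"
proof
  show "1 \<in> {p. \<forall>n. coeff p n \<in> S}"
    by (simp add: coeff_1 one_mem zero_mem)
qed (auto simp: coeff_mult intro!: diff_mem mult_mem sum_mem)

lemma pCons_coeffs_mem:
  assumes "a \<in> S" "\<forall>n. coeff p n \<in> S"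
  shows "\<forall>n. coeff (pCons a p) n \<in> S"
  using assms by (auto simp: coeff_pCons split: nat.splits)

lemma Q_form_mem: "\<iota> \<in> S \<Longrightarrow> u \<in> S \<Longrightarrow> Q_form \<iota> m u \<in> S"
  by (simp add: Q_form_def diff_mem power_mem)

lemma W_form_mem:
  assumes "\<iota> \<in> S" "u \<in> S" "v \<in> S" "w \<in> S"
  shows "W_form \<iota> u v w \<in> S"
proof -
  have "2 \<in> S" using of_nat_mem[of 2] by simp
  then show ?thesis
    unfolding W_form_def using assms by (intro diff_mem add_mem mult_mem power_mem)
qed

end

interpretation Rats: unital_subring "\<rat> :: 'a::field_char_0 set"
  by unfold_locales auto

text \<open>Only the term \<open>i = a\<close> of the convolution survives. Degree bounds suffice,
  so the lemma also covers factors whose top coefficient may vanish.\<close>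

lemma coeff_mult_top:
  fixes p q :: "'a::comm_ring_1 poly"
  assumes "degree p \<le> a" "degree q \<le> b"
  shows "coeff (p * q) (a + b) = coeff p a * coeff q b"
proof -
  have "coeff p i * coeff q (a + b - i) = (if i = a then coeff p a * coeff q b else 0)"
    if "i \<le> a + b" for i
  proof (cases i a rule: linorder_cases)
    case less
    then have "degree q < a + b - i" using assms by linarith
    then show ?thesis using less by (simp add: coeff_eq_0)
  next
    case greater
    then show ?thesis using assms by (simp add: coeff_eq_0)
  qed simp
  then have "(\<Sum>i\<le>a + b. coeff p i * coeff q (a + b - i)) = coeff p a * coeff q b"
    by simp
  then show ?thesis by (simp add: coeff_mult)
qed

text \<open>
  If the coefficients of \<open>E\<close> above degree \<open>j\<close> are rational, the coefficient of \<open>A E\<^sup>3\<close> in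
  degree \<open>d + 2 n + j\<close>, where \<open>d = deg A\<close> and \<open>n = deg E\<close>, is three times the
  coefficient of \<open>E\<close> in degree \<open>j\<close> plus a rational number.
\<close>
lemma cube_factor_Rats:
  fixes A E :: "'a::field_char_0 poly"
  assumes A: "lead_coeff A = 1" "\<forall>i. coeff A i \<in> \<rat>" and E: "lead_coeff E = 1"
    and AE: "\<forall>i. coeff (A * E ^ 3) i \<in> \<rat>"
  shows "coeff E j \<in> \<rat>"
proof (induction "degree E - j" arbitrary: j rule: less_induct)
  case less
  define d n where "d = degree A" and "n = degree E"
  consider "j > n" | "j = n" | "j < n" by linarith
  then show ?case
  proof cases
    case 3
    \<comment> \<open>\<open>E\<close> is split at degree \<open>j\<close>: the upper part
      \<open>T\<close> is rational by induction, and \<open>L\<close> carries the coefficient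
      sought.\<close>
    define L where "L = poly_cutoff (Suc j) E"
    define T where "T = E - L"
    have coeff_L: "coeff L i = (if i \<le> j then coeff E i else 0)" for i
      by (simp add: L_def coeff_poly_cutoff)
    have coeff_T: "coeff T i = (if i \<le> j then 0 else coeff E i)" for i
      by (simp add: T_def coeff_L)
    have T_Rats: "\<forall>i. coeff T i \<in> \<rat>"
    proof
      fix i
      show "coeff T i \<in> \<rat>"
        using less[of i] 3 by (cases "i \<le> n") (auto simp: coeff_T n_def coeff_eq_0)
    qed
    have L: "degree L \<le> j"
      by (intro degree_le) (auto simp: coeff_L)
    have T: "degree T \<le> n"
      by (intro degree_le) (auto simp: coeff_T n_def coeff_eq_0)
    have A_deg: "degree A \<le> d" by (simp add: d_def)
    have AT: "degree (A * T) \<le> d + n"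
      using degree_mult_le[of A T] T by (simp add: d_def)
    have ATT: "degree (A * T * T) \<le> d + n + n"
      using degree_mult_le[of "A * T" T] AT T by simp
    \<comment> \<open>In degree \<open>d + 2 n + j\<close> the first summand is rational, the second
      gives \<open>3 * coeff E j\<close>, and the third vanishes: its two factors \<open>L\<close>
      keep its degree too low because \<open>j < n\<close>.\<close>
    have expand: "A * E ^ 3 = A * T ^ 3 + smult 3 (A * T * T * L) + L * L * (smult 3 (A * T) + A * L)"
    proof -
      have "E = T + L" by (simp add: T_def)
      moreover have "smult 3 p = 3 * p" for p :: "'a poly"
        by (simp add: numeral_poly)
      ultimately show ?thesis
        by (simp add: power3_eq_cube algebra_simps)
    qed
    have "coeff T n = 1"
      using E 3 by (simp add: coeff_T n_def)
    then have "coeff (A * T * T) (d + n + n) = 1"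
      using coeff_mult_top[OF A_deg T] coeff_mult_top[OF AT T] A by (simp add: d_def)
    then have "coeff (A * T * T * L) (d + n + n + j) = coeff E j"
      using coeff_mult_top[OF ATT L] by (simp add: coeff_L)
    moreover have "coeff (L * L * (smult 3 (A * T) + A * L)) (d + n + n + j) = 0"
    proof (rule coeff_eq_0)
      have "degree (A * L) \<le> d + n"
        using degree_mult_le[of A L] L 3 by (simp add: d_def)
      then have "degree (smult 3 (A * T) + A * L) \<le> d + n"
        using AT by (intro degree_add_le) (auto intro: order_trans[OF degree_smult_le])
      moreover have "degree (L * L) \<le> j + j"
        using degree_mult_le[of L L] L by simp
      ultimately show "degree (L * L * (smult 3 (A * T) + A * L)) < d + n + n + j"
        using degree_mult_le[of "L * L" "smult 3 (A * T) + A * L"] 3 by simp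
    qed
    ultimately have "coeff (A * E ^ 3) (d + n + n + j) = coeff (A * T ^ 3) (d + n + n + j) + 3 * coeff E j"
      by (simp add: expand)
    moreover have "coeff (A * T ^ 3) (d + n + n + j) \<in> \<rat>"
    proof -
      interpret P: unital_subring "{p :: 'a poly. \<forall>n. coeff p n \<in> \<rat>}"
        by (rule Rats.unital_subring_poly)
      have "A * T ^ 3 \<in> {p. \<forall>n. coeff p n \<in> \<rat>}"
        using A T_Rats by (intro P.mult_mem P.power_mem) auto
      then show ?thesis by simp
    qed
    ultimately have "3 * coeff E j \<in> \<rat>"
      using AE by (metis Rats_diff add_diff_cancel_left')
    then show ?thesis
      using Rats_divide[of "3 * coeff E j" 3] by simp
  qed (use E in \<open>auto simp: n_def coeff_eq_0\<close>)
qed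

section \<open>Products over orbits of a map of period three\<close>

text \<open>Every orbit that is not a fixed point has exactly three elements, on which
  \<open>g\<close> is constant. The induction removes one such orbit at a time and puts one
  representative into \<open>T\<close>.\<close>

lemma prod_period3_orbits:
  fixes g :: "'b \<Rightarrow> 'a::comm_monoid_mult"
  assumes "finite S" "\<And>x. x \<in> S \<Longrightarrow> \<sigma> x \<in> S" "\<And>x. x \<in> S \<Longrightarrow> \<sigma> (\<sigma> (\<sigma> x)) = x"
    and "\<And>x. x \<in> S \<Longrightarrow> g (\<sigma> x) = g x"
  shows "\<exists>T\<subseteq>S. prod g S = prod g {x \<in> S. \<sigma> x = x} * prod g T ^ 3"
  using assms
proof (induction S rule: finite_psubset_induct)
  case (psubset S)
  show ?case
  proof (cases "\<forall>x\<in>S. \<sigma> x = x")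
    case True
    then have "{x \<in> S. \<sigma> x = x} = S" by auto
    then show ?thesis by (intro exI[of _ "{}"]) simp
  next
    case False
    then obtain x where x: "x \<in> S" "\<sigma> x \<noteq> x" by auto
    have distinct: "\<sigma> (\<sigma> x) \<noteq> x" "\<sigma> (\<sigma> x) \<noteq> \<sigma> x"
      using x psubset.prems(2) by metis+
    define O3 where "O3 = {x, \<sigma> x, \<sigma> (\<sigma> x)}"
    have O3: "O3 \<subseteq> S" "finite O3" "prod g O3 = g x ^ 3"
      using x distinct psubset.prems by (auto simp: O3_def power3_eq_cube mult.assoc)
    have "\<sigma> y \<in> S - O3" if "y \<in> S - O3" for y
      using that psubset.prems(1,2) x by (auto simp: O3_def) metis+
    moreover have "S - O3 \<subset> S"
      using x by (auto simp: O3_def)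
    ultimately obtain T where T: "T \<subseteq> S - O3"
      "prod g (S - O3) = prod g {y \<in> S - O3. \<sigma> y = y} * prod g T ^ 3"
      using psubset.IH[of "S - O3"] psubset.prems by auto
    have fixed: "{y \<in> S - O3. \<sigma> y = y} = {y \<in> S. \<sigma> y = y}"
      using x distinct psubset.prems(2) by (auto simp: O3_def)
    have "finite T" "x \<notin> T"
      using T(1) psubset.hyps by (auto simp: O3_def intro: finite_subset)
    moreover have "prod g S = prod g (S - O3) * prod g O3"
      using O3 psubset.hyps by (simp add: prod.subset_diff)
    ultimately show ?thesis
      using T x O3(3) fixed
      by (intro exI[of _ "insert x T"]) (auto simp: power_mult_distrib mult_ac)
  qed
qed

section \<open>The spectral roots\<close>

definition angle :: "nat \<Rightarrow> nat \<Rightarrow> real" where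
  "angle m a = 2 * pi * real a / real m"

definition spectral_root :: "nat \<Rightarrow> nat \<times> nat \<Rightarrow> real" where
  "spectral_root m = (\<lambda>(a, b). - sin (angle m a) - sin (angle m b) + sin (angle m (a + b)))"

lemma angle_add: "angle m (a + b) = angle m a + angle m b"
  by (simp add: angle_def distrib_left add_divide_distrib)

lemma cis_angle_power: "m > 0 \<Longrightarrow> cis (angle m a) ^ m = 1"
  using cis_multiple_2pi[of "real a"] by (simp add: DeMoivre angle_def mult_ac)

text \<open>The polynomial is separable, as its derivative \<open>m X^(m-1)\<close> shares no root
  with it, and its roots are \<open>\<i>\<close> times the \<open>m\<close>-th roots of
  unity.\<close>

lemma monic_linear_product_roots:
  assumes "m > 0"
  shows "(\<Prod>a<m. [:- (\<i> * cis (angle m a)), 1:]) = [:0, 1:] ^ m - [:\<i> ^ m:]"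
proof -
  define p where "p = [:0, 1:] ^ m - [:\<i> ^ m:]"
  have monic: "lead_coeff p = 1"
  proof -
    have p: "p = monom 1 m + [:- (\<i> ^ m):]"
      by (simp add: p_def x_as_monom monom_power)
    have "degree p = m"
      unfolding p using assms by (subst degree_add_eq_left) (auto simp: degree_monom_eq)
    then show ?thesis using assms by (simp add: p coeff_pCons split: nat.splits)
  qed
  have roots: "{z. poly p z = 0} = {z. z ^ m = \<i> ^ m}"
    by (auto simp: p_def poly_power)
  have "rsquarefree p"
    unfolding rsquarefree_roots
    using assms by (auto simp: p_def pderiv_diff pderiv_power pderiv_pCons poly_power power_0_left)
  then have "p = (\<Prod>z | z ^ m = \<i> ^ m. [:- z, 1:])"
    using complex_poly_decompose_rsquarefree[of p] roots monic by simp
  also have "{z. z ^ m = \<i> ^ m} = (\<lambda>a. \<i> * cis (angle m a)) ` {..<m}"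
  proof -
    have "{z. z ^ m = \<i> ^ m} = (\<lambda>z. \<i> * z) ` {z. z ^ m = 1}"
    proof (intro equalityI subsetI)
      fix z assume "z \<in> {z. z ^ m = \<i> ^ m}"
      then have "(z / \<i>) ^ m = 1" unfolding power_divide by simp
      moreover have "z = \<i> * (z / \<i>)" by simp
      ultimately
      show "z \<in> (\<lambda>z. \<i> * z) ` {z. z ^ m = 1}" by blast
    qed (auto simp: power_mult_distrib)
    also have "{z. z ^ m = 1} = (\<lambda>a. cis (angle m a)) ` {..<m}"
      using bij_betw_roots_unity[OF assms] by (simp add: bij_betw_def angle_def)
    finally show ?thesis by (simp add: image_image)
  qed
  also have "(\<Prod>z\<in>\<dots>. [:- z, 1:]) = (\<Prod>a<m. [:- (\<i> * cis (angle m a)), 1:])"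
    using bij_betw_roots_unity[OF assms]
    by (subst prod.reindex) (auto simp: bij_betw_def angle_def inj_on_def)
  finally show ?thesis by (simp add: p_def)
qed

section \<open>Evaluation of the iterated resultant\<close>

text \<open>Taking \<open>h\<close> to be the embedding of constants at either nesting depth covers
  both \<open>Q_u\<close> and \<open>Q_v\<close>.\<close>

lemma Q_form_eq_prod:
  fixes h :: "complex \<Rightarrow> 'a::comm_ring_1"
  assumes "comm_ring_hom h" "m > 0"
  shows "Q_form [:h \<i>:] m [:0, 1:] = (\<Prod>a<m. [:- h (\<i> * cis (angle m a)), 1:])"
proof -
  interpret comm_ring_hom h by fact
  interpret map_h: map_poly_comm_ring_hom h ..
  have "map_poly h ([:0, 1:] ^ m - [:\<i> ^ m:]) = [:0, 1:] ^ m - [:h \<i> ^ m:]"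
    by (simp add: hom_distribs)
  moreover have "map_poly h (\<Prod>a<m. [:- (\<i> * cis (angle m a)), 1:])
      = (\<Prod>a<m. [:- h (\<i> * cis (angle m a)), 1:])"
    by (simp add: hom_distribs)
  ultimately show ?thesis
    using monic_linear_product_roots[OF assms(2)] by (simp add: Q_form_def poly_const_pow)
qed

lemma W_form_at_roots:
  "W_form [:\<i>:] [:\<i> * cis \<alpha>:] [:\<i> * cis \<beta>:] [:0, 1:] =
    smult (2 * cis \<alpha> * cis \<beta>) [:- complex_of_real (- sin \<alpha> - sin \<beta> + sin (\<alpha> + \<beta>)), 1:]"
proof -
  define x y where "x = cis \<alpha>" and "y = cis \<beta>"
  \<comment> \<open>This is \<open>x - 1/x = 2 \<i> sin \<theta>\<close> for
    \<open>x = cis \<theta>\<close>, cleared of its denominator.\<close>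
  have square: "cis \<theta> * cis \<theta> = 1 + 2 * \<i> * sin \<theta> * cis \<theta>" for \<theta>
    using sin_cos_squared_add[of \<theta>] by (auto simp: complex_eq_iff power2_eq_square algebra_simps)
  have x: "x * x = 1 + 2 * \<i> * sin \<alpha> * x" and y: "y * y = 1 + 2 * \<i> * sin \<beta> * y"
    and xy: "x * y * (x * y) = 1 + 2 * \<i> * sin (\<alpha> + \<beta>) * (x * y)"
    using square[of \<alpha>] square[of \<beta>] square[of "\<alpha> + \<beta>"] by (simp_all add: x_def y_def cis_mult)
  \<comment> \<open>The left side is the part of \<open>W\<close> free of \<open>w\<close> at
    \<open>u = \<i> x\<close>, \<open>v = \<i> y\<close>.\<close>
  have "\<i> * (x * y * (x * y)) - \<i> * (x * x) * y - \<i> * x * (y * y) + \<i> * x + \<i> * y - \<i> =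
      - (2 * x * y * (- sin \<alpha> - sin \<beta> + sin (\<alpha> + \<beta>)))"
    unfolding x y xy by (simp add: algebra_simps)
  then show ?thesis
    unfolding x_def[symmetric] y_def[symmetric]
    by (simp add: W_form_def power2_eq_square numeral_poly algebra_simps)
qed

lemma iterated_resultant_eq_double_prod:
  assumes "m > 0"
  shows "iterated_resultant m = (\<Prod>a<m. \<Prod>b<m.
    W_form [:\<i>:] [:\<i> * cis (angle m a):] [:\<i> * cis (angle m b):] [:0, 1:])"
proof -
  have "comm_ring_hom (\<lambda>z :: complex. [:z:])" "comm_ring_hom (\<lambda>z :: complex. [:[:z:]:])"
    by (unfold_locales; simp add: one_pCons)+
  from this[THEN Q_form_eq_prod, OF assms]
  have Q: "Q_u m = (\<Prod>a<m. [:- [:\<i> * cis (angle m a):], 1:])"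
    "Q_v m = (\<Prod>a<m. [:- [:[:\<i> * cis (angle m a):]:], 1:])"
    by (simp_all only: Q_u_def Q_v_def)
  have "resultant (Q_v m) W_poly =
      (\<Prod>b<m. W_form [:[:\<i>:]:] [:0, 1:] [:[:\<i> * cis (angle m b):]:] [:[:0, 1:]:])"
    unfolding Q by (subst resultant_prod_linear) (simp_all add: W_poly_def W_form_def poly_power)
  then show ?thesis
    unfolding iterated_resultant_def Q
    by (subst resultant_prod_linear) (simp_all add: W_form_def poly_power poly_prod)
qed

text \<open>Each root of unity occurs with exponent \<open>m\<close> in either coordinate and so
  contributes 1; only the \<open>m^2\<close> factors 2 remain.\<close>

lemma prod_roots_of_unity_pairs:
  assumes "m > 0"
  shows "(\<Prod>a<m. \<Prod>b<m. 2 * cis (angle m a) * cis (angle m b)) = 2 ^ (m ^ 2)"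
proof -
  have "(\<Prod>b<m. cis (angle m b)) ^ m = 1"
    using assms by (simp add: prod_power_distrib cis_angle_power)
  then show ?thesis
    using assms
    by (simp add: prod.distrib power_mult_distrib cis_angle_power power2_eq_square flip: power_mult)
qed

section \<open>Spectral pairs and the spectral polynomial\<close>

text \<open>For representatives strictly between 0 and \<open>m\<close>, the sum is 0 modulo
  \<open>m\<close> exactly when it equals \<open>m\<close>.\<close>

definition spectral_pairs :: "nat \<Rightarrow> (nat \<times> nat) set" where
  "spectral_pairs m = {(a, b). 0 < a \<and> a < m \<and> 0 < b \<and> b < m \<and> a + b \<noteq> m}"

lemma spectral_pairs_subset: "spectral_pairs m \<subseteq> {..<m} \<times> {..<m}"
  by (auto simp: spectral_pairs_def)

lemma finite_spectral_pairs [simp]: "finite (spectral_pairs m)"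
  by (rule finite_subset[OF spectral_pairs_subset]) simp

lemma card_spectral_pairs: "card (spectral_pairs m) = (m - 1) * (m - 2)"
proof -
  have "spectral_pairs m = {1..<m} \<times> {1..<m} - (\<lambda>a. (a, m - a)) ` {1..<m}"
    by (auto simp: spectral_pairs_def)
  moreover have "card ((\<lambda>a. (a, m - a)) ` {1..<m}) = m - 1"
    by (subst card_image) (auto simp: inj_on_def)
  moreover have "(\<lambda>a. (a, m - a)) ` {1..<m} \<subseteq> {1..<m} \<times> {1..<m}"
    by auto
  ultimately have "card (spectral_pairs m) = (m - 1) * (m - 1) - (m - 1)"
    by (simp add: card_Diff_subset card_cartesian_product)
  then show ?thesis
    by (simp add: algebra_simps diff_mult_distrib2)
qed

lemma angle_sum_multiple:
  assumes "m > 0" "a + b = k * m"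
  shows "angle m a = 2 * pi * real k - angle m b"
proof -
  have "angle m a + angle m b = angle m (k * m)"
    by (simp add: assms(2) flip: angle_add)
  then show ?thesis
    using assms(1) by (simp add: angle_def)
qed

lemma sin_angle_sum_multiple:
  assumes "m > 0" "a + b = k * m"
  shows "sin (angle m a) = - sin (angle m b)"
proof -
  have "sin (2 * pi * real k) = 0" "cos (2 * pi * real k) = 1"
    using sin_2npi[of k] cos_2npi[of k] by (simp_all only: mult_ac)
  then show ?thesis
    by (simp add: angle_sum_multiple[OF assms] sin_diff)
qed

lemma spectral_root_degenerate:
  assumes "m > 0" "x \<in> {..<m} \<times> {..<m} - spectral_pairs m"
  shows "spectral_root m x = 0"
proof -
  have angle_0: "angle m 0 = 0" by (simp add: angle_def)
  obtain a b where x: "x = (a, b)" by fastforce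
  consider "a = 0" | "b = 0" | "a + b = 1 * m"
    using assms(2) by (auto simp: x spectral_pairs_def)
  then show ?thesis
  proof cases
    case 3
    then show ?thesis
      using sin_angle_sum_multiple[OF assms(1) 3] sin_angle_sum_multiple[OF assms(1), of "a + b" 0 1]
      by (simp add: x spectral_root_def angle_0)
  qed (simp_all add: x spectral_root_def angle_0)
qed

text \<open>Kept over the reals so that the type records that its coefficients are real.\<close>

definition spectral_poly :: "nat \<Rightarrow> real poly" where
  "spectral_poly m = (\<Prod>x\<in>spectral_pairs m. [:- spectral_root m x, 1:])"

lemma map_poly_of_real_spectral_poly:
  "map_poly of_real (spectral_poly m) =
    (\<Prod>x\<in>spectral_pairs m. [:- complex_of_real (spectral_root m x), 1:])"
proof -
  interpret map_poly_comm_ring_hom "of_real :: real \<Rightarrow> complex" ..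
  show ?thesis by (simp add: spectral_poly_def hom_distribs)
qed

lemma iterated_resultant_eq:
  assumes "m > 0"
  shows "iterated_resultant m =
    map_poly of_real (spectral_poly m) * (2 ^ (m ^ 2) * [:0, 1:] ^ (3 * m - 2))"
proof -
  let ?F = "{..<m} \<times> {..<m}" and ?S = "spectral_pairs m"
  let ?f = "\<lambda>x. [:- complex_of_real (spectral_root m x), 1:]"
  have "iterated_resultant m = (\<Prod>a<m. \<Prod>b<m. smult (2 * cis (angle m a) * cis (angle m b)) (?f (a, b)))"
    by (simp add: iterated_resultant_eq_double_prod[OF assms] W_form_at_roots spectral_root_def angle_add)
  also have "\<dots> = smult (2 ^ (m ^ 2)) (\<Prod>a<m. \<Prod>b<m. ?f (a, b))"
    by (simp only: prod_smult prod_roots_of_unity_pairs[OF assms])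
  also have "(\<Prod>a<m. \<Prod>b<m. ?f (a, b)) = prod ?f ?F"
    by (subst prod.cartesian_product) (simp add: case_prod_unfold)
  also have "prod ?f ?F = prod ?f (?F - ?S) * prod ?f ?S"
    by (rule prod.subset_diff[OF spectral_pairs_subset]) simp
  also have "prod ?f (?F - ?S) = [:0, 1:] ^ card (?F - ?S)"
    using spectral_root_degenerate[OF assms] by simp
  also have "card (?F - ?S) = 3 * m - 2"
  proof -
    have "card (?F - ?S) = m * m - (m - 1) * (m - 2)"
      by (simp add: card_Diff_subset spectral_pairs_subset card_spectral_pairs card_cartesian_product)
    moreover have "m * m = (m - 1) * (m - 2) + (3 * m - 2)"
    proof (cases "m \<ge> 2")
      case True
      then obtain k where "m = k + 2" using le_Suc_ex by (metis add.commute)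
      then show ?thesis by (simp add: algebra_simps)
    qed (use assms in \<open>cases m; auto\<close>)
    ultimately show ?thesis by simp
  qed
  finally show ?thesis
    by (simp add: map_poly_of_real_spectral_poly mult_ac numeral_poly poly_const_pow)
qed

lemma D_eq_of_real: "m > 0 \<Longrightarrow> D m = to_fract (map_poly of_real (spectral_poly m))"
  by (simp add: D_def to_fract_def eq_fract iterated_resultant_eq)

text \<open>
  The resultant has coefficients in \<open>\<rat>(\<i>)\<close>, while the spectral roots are real.
\<close>
lemma coeff_spectral_poly_Rats:
  assumes "m > 0"
  shows "coeff (spectral_poly m) k \<in> \<rat>"
proof -
  define G where "G = {z. Re z \<in> \<rat> \<and> Im z \<in> \<rat>}"
  interpret G: unital_subring G
    by unfold_locales (auto simp: G_def)
  interpret G1: unital_subring "{p. \<forall>n. coeff p n \<in> G}"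
    by (rule G.unital_subring_poly)
  interpret G2: unital_subring "{p. \<forall>n. coeff p n \<in> {p. \<forall>n. coeff p n \<in> G}}"
    by (rule G1.unital_subring_poly)
  interpret G3: unital_subring "{p. \<forall>n. coeff p n \<in> {p. \<forall>n. coeff p n \<in> {p. \<forall>n. coeff p n \<in> G}}}"
    by (rule G2.unital_subring_poly)
  have i: "\<i> \<in> G" by (simp add: G_def)
  note mem = i G.zero_mem G.one_mem G1.zero_mem G1.one_mem G2.zero_mem G2.one_mem
    G.pCons_coeffs_mem G1.pCons_coeffs_mem G2.pCons_coeffs_mem
  have "Q_u m \<in> {p. \<forall>n. coeff p n \<in> {p. \<forall>n. coeff p n \<in> G}}"
    unfolding Q_u_def by (intro G2.Q_form_mem CollectI mem) (auto simp: G.zero_mem)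
  moreover have "Q_v m \<in> {p. \<forall>n. coeff p n \<in> {p. \<forall>n. coeff p n \<in> {p. \<forall>n. coeff p n \<in> G}}}"
    unfolding Q_v_def by (intro G3.Q_form_mem CollectI mem) (auto simp: G.zero_mem)
  moreover have "W_poly \<in> {p. \<forall>n. coeff p n \<in> {p. \<forall>n. coeff p n \<in> {p. \<forall>n. coeff p n \<in> G}}}"
    unfolding W_poly_def by (intro G3.W_form_mem CollectI mem) (auto simp: G.zero_mem)
  ultimately have "iterated_resultant m \<in> {p. \<forall>n. coeff p n \<in> G}"
    using G2.resultant_mem[of "Q_v m" W_poly] G1.resultant_mem[of "Q_u m" "resultant (Q_v m) W_poly"]
    unfolding iterated_resultant_def by blast
  \<comment> \<open>The power of \<open>w\<close> only shifts coefficients, and a real number in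
    \<open>G\<close> is rational.\<close>
  moreover have "coeff (iterated_resultant m) (3 * m - 2 + k)
      = of_real (2 ^ (m ^ 2) * coeff (spectral_poly m) k)"
  proof -
    have "iterated_resultant m =
        monom (2 ^ (m ^ 2)) (3 * m - 2) * map_poly of_real (spectral_poly m)"
      unfolding iterated_resultant_eq[OF assms]
      by (simp add: x_as_monom monom_power numeral_poly poly_const_pow smult_monom mult_ac)
    then show ?thesis by (simp add: coeff_monom_mult coeff_map_poly)
  qed
  ultimately have "2 ^ (m ^ 2) * coeff (spectral_poly m) k \<in> \<rat>"
    unfolding G_def by (metis (mono_tags, lifting) Re_complex_of_real mem_Collect_eq)
  then have "2 ^ (m ^ 2) * coeff (spectral_poly m) k / 2 ^ (m ^ 2) \<in> \<rat>"
    by (intro Rats_divide) auto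
  then show ?thesis by simp
qed

text \<open>With \<open>c \<equiv> - a - b\<close> modulo \<open>m\<close> this is the cyclic shift \<open>(a, b, c) \<mapsto> (b, c, a)\<close>.\<close>
definition cyclic_shift :: "nat \<Rightarrow> nat \<times> nat \<Rightarrow> nat \<times> nat" where
  "cyclic_shift m = (\<lambda>(a, b). (b, if a + b < m then m - (a + b) else 2 * m - (a + b)))"

lemma cyclic_shift_mem: "x \<in> spectral_pairs m \<Longrightarrow> cyclic_shift m x \<in> spectral_pairs m"
  by (auto simp: spectral_pairs_def cyclic_shift_def split: if_splits)

lemma cyclic_shift_period:
  "x \<in> spectral_pairs m \<Longrightarrow> cyclic_shift m (cyclic_shift m (cyclic_shift m x)) = x"
  by (auto simp: spectral_pairs_def cyclic_shift_def)

lemma spectral_root_cyclic_shift: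
  assumes "x \<in> spectral_pairs m"
  shows "spectral_root m (cyclic_shift m x) = spectral_root m x"
proof -
  obtain a b where x: "x = (a, b)" by fastforce
  define c where "c = snd (cyclic_shift m x)"
  obtain k where k: "c + (a + b) = k * m"
  proof (cases "a + b < m")
    case True
    then show ?thesis using that[of 1] by (simp add: c_def x cyclic_shift_def)
  next
    case False
    then show ?thesis using that[of 2] assms by (simp add: c_def x cyclic_shift_def spectral_pairs_def)
  qed
  have m: "m > 0" using assms by (auto simp: spectral_pairs_def)
  have "cyclic_shift m x = (b, c)"
    by (simp add: c_def x cyclic_shift_def)
  moreover have "sin (angle m c) = - sin (angle m (a + b))"
    by (rule sin_angle_sum_multiple[OF m k])
  moreover have "sin (angle m (b + c)) = - sin (angle m a)"
    using k by (intro sin_angle_sum_multiple[OF m, of _ _ k]) simp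
  ultimately show ?thesis by (simp add: x spectral_root_def)
qed

lemma cyclic_shift_fixed_iff:
  assumes "x \<in> spectral_pairs m"
  shows "cyclic_shift m x = x \<longleftrightarrow> (\<exists>k. m = 3 * k \<and> x \<in> {(k, k), (2 * k, 2 * k)})"
proof
  obtain a b where x: "x = (a, b)" by fastforce
  assume "cyclic_shift m x = x"
  then have "b = a \<and> (3 * a = m \<or> 3 * a = 2 * m)"
    using assms by (auto simp: x cyclic_shift_def spectral_pairs_def split: if_splits)
  \<comment> \<open>If \<open>3 a = 2 m\<close>, then \<open>a = 2 k\<close> and
    \<open>m = 3 k\<close>, so \<open>2 a - m\<close> recovers \<open>k\<close>.\<close>
  moreover define k where "k = (if 3 * a = m then a else 2 * a - m)"
  ultimately have "m = 3 * k \<and> x \<in> {(k, k), (2 * k, 2 * k)}"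
    by (auto simp: x)
  then show "\<exists>k. m = 3 * k \<and> x \<in> {(k, k), (2 * k, 2 * k)}" by blast
qed (auto simp: cyclic_shift_def)

lemma fixed_point_factor:
  assumes "m > 0"
  shows "(\<Prod>x \<in> {x \<in> spectral_pairs m. cyclic_shift m x = x}. [:- spectral_root m x, 1:]) =
    (if 3 dvd m then [:0, 1:] ^ 2 - [:27 / 4:] else 1)"
proof (cases "3 dvd m")
  case True
  then obtain k where k: "m = 3 * k" by blast
  have "k > 0" using assms k by simp
  then have fixed: "{x \<in> spectral_pairs m. cyclic_shift m x = x} = {(k, k), (2 * k, 2 * k)}"
    using cyclic_shift_fixed_iff[of _ m] by (auto simp: k spectral_pairs_def)
  \<comment> \<open>The second angle is written as \<open>pi + pi / 3\<close> so that the addition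
    formulas reduce it to the known values at \<open>pi / 3\<close>.\<close>
  have angles: "angle m k = 2 * pi / 3" "angle m (2 * k) = pi + pi / 3"
    using \<open>k > 0\<close> by (simp_all add: angle_def k field_simps)
  have "sin (angle m k) = sqrt 3 / 2" "cos (angle m k) = - 1 / 2"
    "sin (angle m (2 * k)) = - (sqrt 3 / 2)" "cos (angle m (2 * k)) = - 1 / 2"
    unfolding angles sin_add cos_add by (simp_all add: sin_60 cos_60 sin_120 cos_120)
  then have roots: "spectral_root m (k, k) = - 3 * sqrt 3 / 2"
    "spectral_root m (2 * k, 2 * k) = 3 * sqrt 3 / 2"
    by (simp_all only: spectral_root_def angle_add prod.case sin_add)
  show ?thesis
    unfolding fixed using True \<open>k > 0\<close> by (simp add: roots power2_eq_square)
next
  case False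
  then have fixed: "{x \<in> spectral_pairs m. cyclic_shift m x = x} = {}"
    using cyclic_shift_fixed_iff[of _ m] by auto
  show ?thesis unfolding fixed using False by simp
qed

section \<open>Descent to rational polynomials and the degree count\<close>

lemma Rats_coeffs_imp_of_rat_poly:
  fixes p :: "'a::field_char_0 poly"
  assumes "\<And>i. coeff p i \<in> \<rat>"
  obtains q where "p = map_poly of_rat q"
proof
  \<comment> \<open>\<open>coeff_map_poly\<close> requires a map that sends 0 to 0.\<close>
  have inv_0: "inv_into UNIV (of_rat :: rat \<Rightarrow> 'a) 0 = 0"
    by (metis inv_f_f inj_def of_rat_0 of_rat_eq_iff)
  show "p = map_poly of_rat (map_poly (inv_into UNIV of_rat) p)"
    using assms by (intro poly_eqI) (simp add: coeff_map_poly inv_0 f_inv_into_f Rats_def)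
qed

theorem theorem1p3:
  fixes m :: nat
  assumes "m \<ge> 3"
  shows "\<exists>E :: rat poly.
     D m = to_fract (map_poly of_rat
             (if 3 dvd m then ([:0, 1:] ^ 2 - [:27 / 4:]) * E ^ 3 else E ^ 3)) \<and>
     real (degree E) =
       (if 3 dvd m then ((real m - 1) * (real m - 2) - 2) / 3
        else (real m - 1) * (real m - 2) / 3)"
proof -
  have m: "m > 0" using assms by simp
  interpret of_rat_poly: map_poly_inj_idom_hom "of_rat :: rat \<Rightarrow> real"
    by unfold_locales (auto simp: of_rat_add of_rat_mult)
  \<comment> \<open>\<open>A\<close> and \<open>A'\<close> are the factor of the fixed points over
    the reals and over the rationals.\<close>
  define A :: "real poly" where "A = (if 3 dvd m then [:0, 1:] ^ 2 - [:27 / 4:] else 1)"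
  define A' :: "rat poly" where "A' = (if 3 dvd m then [:0, 1:] ^ 2 - [:27 / 4:] else 1)"
  obtain T where T: "spectral_poly m = A * (\<Prod>x\<in>T. [:- spectral_root m x, 1:]) ^ 3"
    using prod_period3_orbits[of "spectral_pairs m" "cyclic_shift m" "\<lambda>x. [:- spectral_root m x, 1:]"]
    by (auto simp: cyclic_shift_mem cyclic_shift_period spectral_root_cyclic_shift
        spectral_poly_def A_def fixed_point_factor[OF m])
  define E where "E = (\<Prod>x\<in>T. [:- spectral_root m x, 1:])"
  have "lead_coeff E = 1"
    by (simp add: E_def lead_coeff_prod)
  have A: "A = map_poly of_rat A'" "lead_coeff A = 1" "degree A = (if 3 dvd m then 2 else 0)"
    by (auto simp: A_def A'_def power2_eq_square of_rat_divide of_rat_minus)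
  have "coeff E j \<in> \<rat>" for j
    using A T \<open>lead_coeff E = 1\<close> coeff_spectral_poly_Rats[OF m]
    by (intro cube_factor_Rats[of A]) (auto simp: E_def)
  then obtain E' where E': "E = map_poly of_rat E'"
    using Rats_coeffs_imp_of_rat_poly by blast
  have "spectral_poly m = map_poly of_rat (A' * E' ^ 3)"
    using T A(1) E' by (simp add: E_def of_rat_poly.hom_mult of_rat_poly.hom_power)
  \<comment> \<open>The embedding of the rationals into the complex numbers factors through the
    reals, which carries the real identity over to \<open>D\<close>.\<close>
  moreover have "of_real (of_rat q :: real) = (of_rat q :: complex)" for q
    by (cases q) (simp add: of_rat_rat)
  then have "map_poly of_real (map_poly of_rat p :: real poly) = (map_poly of_rat p :: complex poly)" for p
    by (simp add: poly_eq_iff coeff_map_poly)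
  ultimately have "D m = to_fract (map_poly of_rat (A' * E' ^ 3))"
    using D_eq_of_real[OF m] by simp
  moreover have "E \<noteq> 0" "A \<noteq> 0"
    using \<open>lead_coeff E = 1\<close> A(2) by auto
  then have "degree (spectral_poly m) = degree A + 3 * degree E"
    unfolding T E_def[symmetric] by (simp add: power3_eq_cube degree_mult_eq)
  then have "(m - 1) * (m - 2) = degree A + 3 * degree E'"
    by (simp add: spectral_poly_def degree_prod_linear card_spectral_pairs E')
  then have "real (m - 1) * real (m - 2) = real (degree A) + 3 * real (degree E')"
    by (metis of_nat_add of_nat_mult of_nat_numeral)
  then have "(real m - 1) * (real m - 2) = real (degree A) + 3 * real (degree E')"
    using assms by (simp add: of_nat_diff)
  then have "real (degree E') = (if 3 dvd m then ((real m - 1) * (real m - 2) - 2) / 3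
        else (real m - 1) * (real m - 2) / 3)"
    by (simp add: A(3))
  ultimately show ?thesis
    by (intro exI[of _ E']) (simp add: A'_def)
qed

end
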